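(* Let $V$ be a finite-dimensional real vector space and let $K\subset V$ be a regular cone. Let $L\subset V$ be a proper affine subspace with $\operatorname{codim}(L)\geq 2$ and $(-K)\cap L=\emptyset$, and let $\widehat{L}$ be the linear span of $L$ in $V$. Then $K\cap\widehat{L}=\{0\}$ if and only if $K\cap L$ is stably infeasible. In particular, there exists a linear functional $\ell\in\operatorname{int}(K^\vee)$ with $\ell(x)<0$ for all $x\in L$ if and only if $K\cap L$ is stably infeasible.
   Context: A regular cone in $V$ is a closed convex cone (closed under multiplication by nonnegative scalars) that is pointed ($K\cap(-K)=\{0\}$) and has non-empty interior. The dual cone is $K^\vee=\{\ell\in V^*: \ell(x)\geq 0\ \text{for all } x\in K\}$ and $\operatorname{int}$ denotes Euclidean interior. An affine subspace $L\subset V$ is called proper if $0\notin L$. For a $d$-dimensional affine subspace $L\subset V$, $K\cap L$ is stably infeasible if there exists an open neighborhood $N$ of $L$ in the Grassmannian of $d$-dimensional affine subspaces of $V$ such that $K\cap L'=\emptyset$ for all $L'\in N$. The Grassmannian of $d$-dimensional affine subspaces of $V$ carries its usual topology: identify an affine subspace $L$ with the $(d+1)$-dimensional linear subspace of $\mathbb{R}\oplus V$ spanned by $\{1\}\times L$; this realizes it as the open subset of the Grassmannian of $(d+1)$-dimensional linear subspaces of $\mathbb{R}\oplus V$ consisting of those not contained in $\{0\}\oplus V$. *)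

theory Defs
  imports "HOL-Analysis.Analysis"
begin

definition regular_cone :: "'a::euclidean_space set \<Rightarrow> bool" where
  "regular_cone K \<longleftrightarrow>
     closed K \<and> convex K \<and> cone K \<and> K \<inter> uminus ` K = {0} \<and> interior K \<noteq> {}"

text \<open>The dual space is modelled by the type of bounded linear functionals with its norm topology;
  in finite dimension these are all the linear functionals.\<close>

definition dual_cone :: "'a::euclidean_space set \<Rightarrow> ('a \<Rightarrow>\<^sub>L real) set" where
  "dual_cone K = {l. \<forall>x\<in>K. blinfun_apply l x \<ge> 0}"

definition frames :: "nat \<Rightarrow> (nat \<Rightarrow> 'a::euclidean_space) set" where
  "frames k = {b \<in> {..<k} \<rightarrow>\<^sub>E UNIV. inj_on b {..<k} \<and> independent (b ` {..<k})}"

definition frame_topology :: "nat \<Rightarrow> (nat \<Rightarrow> 'a::euclidean_space) topology" where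
  "frame_topology k = subtopology (product_topology (\<lambda>_. euclidean) {..<k}) (frames k)"

text \<open>The Grassmannian of linear subspaces of dimension \<open>k\<close>, with the quotient topology along the
  map sending a frame to its span (see \<open>quotient_map_grassmannian\<close> below).\<close>

definition grassmannian :: "nat \<Rightarrow> 'a::euclidean_space set topology" where
  "grassmannian k = topology (\<lambda>N. N \<subseteq> {W. subspace W \<and> dim W = k} \<and>
     openin (frame_topology k) {b \<in> frames k. span (b ` {..<k}) \<in> N})"

definition homogenization :: "'a::euclidean_space set \<Rightarrow> (real \<times> 'a) set" where
  "homogenization L = span ({1} \<times> L)"

text \<open>Since \<open>aff_dim {} = -1\<close>, the empty set is not a point of any affine Grassmannian.\<close>

definition affine_grassmannian :: "nat \<Rightarrow> 'a::euclidean_space set topology" where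
  "affine_grassmannian d =
     pullback_topology {L. affine L \<and> aff_dim L = int d} homogenization (grassmannian (d + 1))"

definition stably_infeasible :: "'a::euclidean_space set \<Rightarrow> 'a set \<Rightarrow> bool" where
  "stably_infeasible K L \<longleftrightarrow>
     (\<exists>N. openin (affine_grassmannian (nat (aff_dim L))) N \<and> L \<in> N \<and> (\<forall>L'\<in>N. K \<inter> L' = {}))"

lemma topspace_frame_topology [simp]: "topspace (frame_topology k) = frames k"
  by (auto simp: frame_topology_def frames_def)

lemma span_frame:
  assumes "b \<in> frames k"
  shows "subspace (span (b ` {..<k}))" "dim (span (b ` {..<k})) = k"
  using assms by (auto simp: frames_def dim_eq_card_independent card_image)

lemma frame_exists:
  fixes W :: "'a::euclidean_space set"
  assumes "subspace W" "dim W = k"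
  shows "\<exists>b\<in>frames k. span (b ` {..<k}) = W"
proof -
  obtain B where B: "B \<subseteq> W" "independent B" "W \<subseteq> span B" "card B = dim W"
    using basis_exists by blast
  then have "finite B" using independent_imp_finite by blast
  then obtain f where f: "bij_betw f {..<k} B"
    using B(4) assms(2) ex_bij_betw_nat_finite[of B] by (auto simp: lessThan_atLeast0)
  let ?b = "restrict f {..<k}"
  have im: "?b ` {..<k} = B" using f by (auto simp: bij_betw_def)
  have "?b \<in> frames k"
    using f B(2) im by (auto simp: frames_def bij_betw_def)
  moreover have "span B = W"
    using B assms(1) span_subspace by blast
  ultimately show ?thesis using im by metis
qed

lemma openin_grassmannian:
  fixes N :: "'a::euclidean_space set set"
  shows "openin (grassmannian k) N \<longleftrightarrow>
     N \<subseteq> {W. subspace W \<and> dim W = k} \<and>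
     openin (frame_topology k) {b \<in> frames k. span (b ` {..<k}) \<in> N}"
proof -
  have "istopology (\<lambda>N :: 'a set set. N \<subseteq> {W. subspace W \<and> dim W = k} \<and>
     openin (frame_topology k) {b \<in> frames k. span (b ` {..<k}) \<in> N})" (is "istopology ?P")
    unfolding istopology_def
  proof (intro conjI allI impI)
    fix S T assume S: "?P S" and T: "?P T"
    have "{b \<in> frames k. span (b ` {..<k}) \<in> S \<inter> T} =
        {b \<in> frames k. span (b ` {..<k}) \<in> S} \<inter> {b \<in> frames k. span (b ` {..<k}) \<in> T}"
      by blast
    then show "openin (frame_topology k) {b \<in> frames k. span (b ` {..<k}) \<in> S \<inter> T}"
      using openin_Int[OF conjunct2[OF S] conjunct2[OF T]] by simp
  next
    fix \<K> assume K: "\<forall>S\<in>\<K>. ?P S"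
    have "{b \<in> frames k. span (b ` {..<k}) \<in> \<Union>\<K>} =
        (\<Union>S\<in>\<K>. {b \<in> frames k. span (b ` {..<k}) \<in> S})"
      by blast
    moreover have "openin (frame_topology k) (\<Union>S\<in>\<K>. {b \<in> frames k. span (b ` {..<k}) \<in> S})"
      using K by (intro openin_Union) blast
    ultimately show "openin (frame_topology k) {b \<in> frames k. span (b ` {..<k}) \<in> \<Union>\<K>}"
      by simp
  qed blast+
  then show ?thesis unfolding grassmannian_def by (simp only: topology_inverse')
qed

lemma topspace_grassmannian [simp]: "topspace (grassmannian k) = {W :: 'a::euclidean_space set. subspace W \<and> dim W = k}"
proof -
  have "{b \<in> frames k. span (b ` {..<k}) \<in> {W :: 'a set. subspace W \<and> dim W = k}} = frames k"
    using span_frame by blast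
  moreover have "openin (frame_topology k) (frames k :: (nat \<Rightarrow> 'a) set)"
    using openin_topspace[of "frame_topology k :: (nat \<Rightarrow> 'a) topology"] by simp
  ultimately have 1: "openin (grassmannian k) {W :: 'a set. subspace W \<and> dim W = k}"
    by (simp only: openin_grassmannian subset_refl simp_thms)
  have "topspace (grassmannian k) \<subseteq> {W :: 'a set. subspace W \<and> dim W = k}"
    using openin_topspace[of "grassmannian k :: 'a set topology"] unfolding openin_grassmannian by (rule conjunct1)
  then show ?thesis using openin_subset[OF 1] by (rule subset_antisym)
qed

lemma quotient_map_grassmannian:
  "quotient_map (frame_topology k) (grassmannian k)
     (\<lambda>b. span (b ` {..<k}) :: 'a::euclidean_space set)"
proof -
  have "(\<lambda>b. span (b ` {..<k}) :: 'a set) ` frames k = {W. subspace W \<and> dim W = k}"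
    using span_frame frame_exists by fast
  then show ?thesis
    by (auto simp: quotient_map_def openin_grassmannian)
qed

lemma dim_homogenization:
  fixes L :: "'a::euclidean_space set"
  assumes "affine L" "aff_dim L = int d"
  shows "dim (homogenization L) = d + 1"
proof -
  have eq: "{1} \<times> L = (+) (1, 0) ` (\<lambda>x. (0::real, x)) ` L" by force
  have lin: "linear (\<lambda>x::'a. (0::real, x))" by (simp add: linear_iff)
  have "aff_dim ({1::real} \<times> L) = aff_dim ((\<lambda>x. (0::real, x)) ` L)"
    unfolding eq by (rule aff_dim_translation_eq)
  also have "\<dots> = aff_dim L"
    by (rule aff_dim_injective_linear_image[OF lin]) (simp add: inj_on_def)
  finally have 1: "aff_dim ({1::real} \<times> L) = int d" using assms by simp
  have aff: "affine ({1::real} \<times> L)" using assms(1) by (auto simp: affine_def)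
  have 0: "(0, 0) \<notin> affine hull ({1::real} \<times> L)"
    unfolding affine_hull_eq[THEN iffD2, OF aff] by simp
  have "int (dim (homogenization L)) = aff_dim (insert 0 ({1::real} \<times> L))"
    by (subst aff_dim_zero) (auto simp: hull_inc homogenization_def, metis dim_span span_insert_0)
  also have "\<dots> = int d + 1"
    using 0 1 by (simp add: aff_dim_insert zero_prod_def)
  finally show ?thesis by simp
qed

lemma homogenization_slice:
  fixes L :: "'a::euclidean_space set"
  assumes "affine L"
  shows "(1, x) \<in> homogenization L \<longleftrightarrow> x \<in> L"
proof
  assume x: "(1, x) \<in> homogenization L"
  have "homogenization L \<subseteq> {(t, y). \<forall>z\<in>L. y + (1 - t) *\<^sub>R z \<in> L}"
  proof -
    define C where "C = {(t, y). \<forall>z\<in>L. y + (1 - t) *\<^sub>R z \<in> L}"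
    have "subspace C" unfolding subspace_def
    proof (intro conjI ballI allI)
      show "0 \<in> C" by (simp add: C_def zero_prod_def)
    next
      fix p q assume pq: "p \<in> C" "q \<in> C"
      obtain s u t v where st: "p = (s, u)" "q = (t, v)" by (cases p, cases q)
      have "(u + v) + (1 - (s + t)) *\<^sub>R z \<in> L" if z: "z \<in> L" for z
      proof -
        have a: "u + (1 - s) *\<^sub>R z \<in> L" "v + (1 - t) *\<^sub>R z \<in> L"
          using pq st z by (auto simp: C_def)
        have "(u + (1 - s) *\<^sub>R z) + 1 *\<^sub>R ((v + (1 - t) *\<^sub>R z) - z) \<in> L"
          using mem_affine_3_minus[OF assms a(1) a(2) z, of 1] .
        then show ?thesis by (simp add: algebra_simps)
      qed
      then show "p + q \<in> C" by (auto simp: C_def st)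
    next
      fix c p assume p: "p \<in> C"
      obtain s u where st: "p = (s, u)" by (cases p)
      have "c *\<^sub>R u + (1 - c * s) *\<^sub>R z \<in> L" if z: "z \<in> L" for z
      proof -
        have a: "u + (1 - s) *\<^sub>R z \<in> L"
          using p st z by (auto simp: C_def)
        have "z + c *\<^sub>R ((u + (1 - s) *\<^sub>R z) - z) \<in> L"
          using mem_affine_3_minus[OF assms z a z, of c] .
        then show ?thesis by (simp add: algebra_simps)
      qed
      then show "c *\<^sub>R p \<in> C" by (auto simp: C_def st)
    qed
    moreover have "{1} \<times> L \<subseteq> C" by (auto simp: C_def)
    ultimately show ?thesis unfolding homogenization_def C_def[symmetric] by (rule span_minimal[rotated])
  qed
  moreover have "L \<noteq> {}"
    using x by (auto simp: homogenization_def zero_prod_def)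
  ultimately show "x \<in> L" using x by auto
qed (auto simp: homogenization_def intro: span_base)

lemma inj_on_homogenization: "inj_on homogenization {L. affine L}"
proof (rule inj_onI)
  fix L M :: "'a set"
  assume "L \<in> {L. affine L}" "M \<in> {L. affine L}" "homogenization L = homogenization M"
  then have "x \<in> L \<longleftrightarrow> x \<in> M" for x
    using homogenization_slice by (metis mem_Collect_eq)
  then show "L = M" by blast
qed

lemma topspace_affine_grassmannian [simp]:
  "topspace (affine_grassmannian d) = {L. affine L \<and> aff_dim L = int d}"
  using dim_homogenization
  by (fastforce simp: affine_grassmannian_def topspace_pullback_topology homogenization_def)

end

theory Submission
  imports Defs
begin

text \<open>Homogenizing turns \<open>K \<inter> L = {}\<close> into a statement about the linear space \<open>homogenization L\<close>
  and the closed cone \<open>{0..} \<times> K\<close>. If \<open>K \<inter> span L = {0}\<close>, the two meet only in \<open>0\<close>, and by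
  compactness of the unit sphere of coefficients this is an open condition on the linear space.
  Conversely, a nonzero \<open>x \<in> K \<inter> span L\<close> is either a multiple of a point of \<open>L\<close>, which puts a
  point of \<open>K\<close> or \<open>-K\<close> on \<open>L\<close>, or a direction of \<open>L\<close>; in the latter case an arbitrarily small
  linear perturbation of \<open>L\<close> tilts this direction into the interior of \<open>K\<close>, and the tilted space
  meets \<open>K\<close>. The functional is obtained by strictly separating the directions of \<open>L\<close> from the
  convex hull of \<open>- y\<close> (for some \<open>y \<in> L\<close>) and the unit vectors of \<open>K\<close>.\<close>

section \<open>Open sets in Grassmannians\<close>

lemma span_frame_eq:
  fixes b :: "nat \<Rightarrow> 'a::euclidean_space"
  assumes "b \<in> frames k"
  shows "span (b ` {..<k}) = range (\<lambda>c. \<Sum>i<k. c i *\<^sub>R b i)"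
proof -
  have inj: "inj_on b {..<k}" using assms by (simp add: frames_def)
  have "span (b ` {..<k}) = range (\<lambda>u. \<Sum>i<k. u (b i) *\<^sub>R b i)"
    by (simp add: span_finite sum.reindex[OF inj])
  moreover have "(\<Sum>i<k. c i *\<^sub>R b i) \<in> range (\<lambda>u. \<Sum>i<k. u (b i) *\<^sub>R b i)" for c
  proof
    show "(\<Sum>i<k. c i *\<^sub>R b i) =
        (\<Sum>i<k. (\<lambda>v. c (inv_into {..<k} b v)) (b i) *\<^sub>R b i)"
      using inj by (intro sum.cong) auto
  qed simp
  ultimately show ?thesis by auto
qed

lemma frame_sum_nonzero:
  fixes b :: "nat \<Rightarrow> 'a::euclidean_space"
  assumes b: "b \<in> frames k" and i: "i < k" "c i \<noteq> 0"
  shows "(\<Sum>i<k. c i *\<^sub>R b i) \<noteq> 0"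
proof
  assume 0: "(\<Sum>i<k. c i *\<^sub>R b i) = 0"
  have inj: "inj_on b {..<k}" and ind: "independent (b ` {..<k})"
    using b by (simp_all add: frames_def)
  let ?u = "\<lambda>v. c (inv_into {..<k} b v)"
  have "(\<Sum>v\<in>b ` {..<k}. ?u v *\<^sub>R v) = (\<Sum>i<k. c i *\<^sub>R b i)"
    using inj by (simp add: sum.reindex)
  then have "?u (b i) = 0"
    using independentD[OF ind, of "b ` {..<k}" ?u "b i"] i(1) 0 by simp
  then show False using inj i by simp
qed

text \<open>The coefficients live in an arbitrary \<open>S\<close> so that they can later be
  confined to a compact cube.\<close>

lemma continuous_map_frame_sum:
  "continuous_map (prod_topology (frame_topology k) (product_topology (\<lambda>_. top_of_set S) {..<k}))
     euclidean (\<lambda>(b, c). \<Sum>i<k. c i *\<^sub>R (b i :: 'a::euclidean_space))"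
  (is "continuous_map ?X _ _")
proof -
  have b: "continuous_map ?X euclidean (\<lambda>p. fst p i)" if "i < k" for i
    unfolding frame_topology_def using that
    by (intro continuous_map_compose[OF continuous_map_fst, unfolded o_def]
        continuous_map_from_subtopology continuous_map_product_projection) simp
  have "continuous_map ?X (top_of_set S) (\<lambda>p. snd p i)" if "i < k" for i
    using that
    by (intro continuous_map_compose[OF continuous_map_snd, unfolded o_def]
        continuous_map_product_projection) simp
  then have c: "continuous_map ?X euclidean (\<lambda>p. snd p i)" if "i < k" for i
    using that by (simp add: continuous_map_in_subtopology)
  show ?thesis
    using b c unfolding continuous_map_atin limitin_canonical_iff case_prod_beta
    by (auto intro!: tendsto_sum tendsto_scaleR)
qed

text \<open>The frames whose span meets \<open>C\<close> outside 0 form the projection of a closed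
  set along a compact space of coefficients, hence a closed set. Compactness is available because
  \<open>C\<close> is a cone: a nonzero vector of it may be rescaled until its largest coefficient
  has modulus 1.\<close>

lemma openin_grassmannian_Int_cone:
  fixes C :: "'a::euclidean_space set"
  assumes "closed C" "cone C"
  shows "openin (grassmannian k) {W. subspace W \<and> dim W = k \<and> W \<inter> C \<subseteq> {0}}"
proof -
  define P where "P = product_topology (\<lambda>_. top_of_set {-1..1::real}) {..<k}"
  define X :: "((nat \<Rightarrow> 'a) \<times> (nat \<Rightarrow> real)) topology" where
    "X = prod_topology (frame_topology k) P"
  define g where "g = (\<lambda>(b :: nat \<Rightarrow> 'a, c). \<Sum>i<k. c i *\<^sub>R b i)"
  \<comment> \<open>The coefficients lie on the boundary of the cube, that is, on the unit sphere of
    the maximum norm. On it the combination of a frame never vanishes. The finite union over the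
    extremal coordinate makes closedness easy to check.\<close>
  define Z where "Z = (\<Union>i<k. {p \<in> topspace X. snd p i \<in> {-1,1}} \<inter> {p \<in> topspace X. g p \<in> C})"
  have P: "compact_space P"
    unfolding P_def
    by (simp add: compact_space_product_topology compact_space_subtopology)
  have "closedin X Z"
    unfolding Z_def
  proof (intro closedin_Union; clarsimp)
    fix i assume i: "i < k"
    have "continuous_map X (top_of_set {-1..1}) (\<lambda>p. snd p i)"
      unfolding X_def P_def using i
      by (intro continuous_map_compose[OF continuous_map_snd, unfolded o_def]
          continuous_map_product_projection) simp
    then have "continuous_map X euclidean (\<lambda>p. snd p i)"
      by (simp add: continuous_map_in_subtopology)
    then have 1: "closedin X {p \<in> topspace X. snd p i \<in> {-1,1}}"
      by (rule closedin_continuous_map_preimage) simp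
    have "continuous_map X euclidean g"
      unfolding X_def P_def g_def by (rule continuous_map_frame_sum)
    then have "closedin X {p \<in> topspace X. g p \<in> C}"
      by (rule closedin_continuous_map_preimage) (simp add: assms)
    from closedin_Int[OF 1 this]
    show "closedin X ({p \<in> topspace X. snd p i = - 1 \<or> snd p i = 1} \<inter> {p \<in> topspace X. g p \<in> C})"
      by simp
  qed
  \<comment> \<open>Projecting away the compact factor \<open>P\<close> is a closed map.\<close>
  then have closed: "closedin (frame_topology k) (fst ` Z)"
    using Abstract_Topological_Spaces.closed_map_fst[OF P, of "frame_topology k :: (nat \<Rightarrow> 'a) topology"]
    by (simp add: closed_map_def X_def)
  have "{b \<in> frames k. span (b ` {..<k}) \<inter> C \<subseteq> {0}} = frames k - fst ` Z"
  proof (intro set_eqI iffI)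
    fix b assume b: "b \<in> {b \<in> frames k. span (b ` {..<k}) \<inter> C \<subseteq> {0}}"
    have False if "(b, c) \<in> Z" for c
    proof -
      have "\<exists>i<k. c i \<in> {-1,1} \<and> g (b, c) \<in> C"
        using that by (simp add: Z_def) blast
      then obtain i where i: "i < k" "c i \<in> {-1,1}" and gC: "g (b, c) \<in> C"
        by blast
      have "g (b, c) \<noteq> 0"
        using frame_sum_nonzero[of b k i c] b i by (auto simp: g_def)
      moreover have "g (b, c) \<in> span (b ` {..<k})"
        using b by (auto simp: g_def span_frame_eq)
      ultimately show False using b gC by blast
    qed
    then show "b \<in> frames k - fst ` Z" using b by force
  next
    fix b assume b: "b \<in> frames k - fst ` Z"
    have False if x: "x \<in> span (b ` {..<k})" "x \<in> C" "x \<noteq> 0" for x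
    proof -
      obtain c where c: "x = (\<Sum>i<k. c i *\<^sub>R b i)"
        using x(1) b span_frame_eq[of b k] by auto
      have "k > 0" using c x(3) by (cases k) auto
      then have ne: "(\<lambda>i. \<bar>c i\<bar>) ` {..<k} \<noteq> {}" by auto
      define m where "m = Max ((\<lambda>i. \<bar>c i\<bar>) ` {..<k})"
      obtain i where i: "i < k" "m = \<bar>c i\<bar>"
        using Max_in[OF _ ne] by (auto simp: m_def)
      have le: "\<bar>c j\<bar> \<le> m" if "j < k" for j
        unfolding m_def using that by (intro Max_ge) auto
      have "m \<noteq> 0"
      proof
        assume "m = 0"
        then have "x = 0" unfolding c using le by (intro sum.neutral) auto
        then show False using x(3) by simp
      qed
      then have m: "m > 0" using i(2) by simp
      \<comment> \<open>Division by the largest modulus puts the coefficients on the boundary of the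
        cube. The restriction is needed because points of the product topology are extensional
        functions.\<close>
      define c' where "c' = restrict (\<lambda>i. c i / m) {..<k}"
      have "c' \<in> topspace P"
      proof -
        have "c j / m \<in> {-1..1}" if "j < k" for j
          using le[OF that] m by (auto simp: field_simps abs_le_iff)
        then show ?thesis by (simp add: P_def c'_def)
      qed
      moreover have "c' i \<in> {-1, 1}"
        using i m by (auto simp: c'_def abs_if split: if_splits)
      moreover have "g (b, c') = (1 / m) *\<^sub>R x"
        by (simp add: g_def c'_def c scaleR_sum_right)
      then have "g (b, c') \<in> C"
        using assms(2) x(2) m by (simp add: cone_def)
      ultimately have "(b, c') \<in> Z"
        using b i(1) by (auto simp: Z_def X_def)
      then show False using b by force
    qed
    then show "b \<in> {b \<in> frames k. span (b ` {..<k}) \<inter> C \<subseteq> {0}}" using b by auto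
  qed
  moreover have "{b \<in> frames k. span (b ` {..<k}) \<in> {W. subspace W \<and> dim W = k \<and> W \<inter> C \<subseteq> {0}}} =
      {b \<in> frames k. span (b ` {..<k}) \<inter> C \<subseteq> {0}}"
    using span_frame by blast
  moreover have "openin (frame_topology k) (frames k - fst ` Z)"
    using closed by (simp add: closedin_def)
  ultimately show ?thesis
    unfolding openin_grassmannian by auto
qed

section \<open>Linear perturbations of an affine subspace\<close>

lemma homogenization_linear_image:
  fixes T :: "'a::euclidean_space \<Rightarrow> 'b::euclidean_space"
  assumes "linear T"
  shows "homogenization (T ` L) = map_prod id T ` homogenization L"
proof -
  have "linear (map_prod id T :: real \<times> 'a \<Rightarrow> real \<times> 'b)"
    using assms by (auto simp: linear_iff)
  moreover have "{1::real} \<times> T ` L = map_prod id T ` ({1} \<times> L)" by force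
  ultimately show ?thesis
    by (simp add: homogenization_def linear_span_image)
qed

lemma limitin_affine_grassmannian_linear_image:
  fixes T :: "'b \<Rightarrow> 'a::euclidean_space \<Rightarrow> 'a"
  assumes L: "affine L" "aff_dim L = int d"
    and T: "\<forall>\<^sub>F e in F. linear (T e) \<and> inj (T e)"
    and lim: "\<And>x. ((\<lambda>e. T e x) \<longlongrightarrow> x) F"
  shows "limitin (affine_grassmannian d) (\<lambda>e. T e ` L) L F"
  unfolding limitin_def
proof (intro conjI allI impI)
  show "L \<in> topspace (affine_grassmannian d)" using L by simp
next
  fix N assume N: "openin (affine_grassmannian d) N \<and> L \<in> N"
  then obtain U where U: "openin (grassmannian (d + 1)) U"
    and NU: "N = homogenization -` U \<inter> {L. affine L \<and> aff_dim L = int d}"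
    by (auto simp: affine_grassmannian_def openin_pullback_topology)
  let ?k = "d + 1"
  obtain b where b: "b \<in> frames ?k" "span (b ` {..<?k}) = homogenization L"
    using frame_exists[of "homogenization L" ?k] dim_homogenization[OF L]
    by (auto simp: homogenization_def)
  define A :: "'b \<Rightarrow> real \<times> 'a \<Rightarrow> real \<times> 'a" where "A = (\<lambda>e. map_prod id (T e))"
  define b' where "b' = (\<lambda>e. restrict (\<lambda>i. A e (b i)) {..<?k})"
  have im: "b' e ` {..<?k} = A e ` (b ` {..<?k})" for e
    by (auto simp: b'_def)
  have A: "linear (A e)" "inj (A e)" if "linear (T e)" "inj (T e)" for e
    using that by (auto simp: A_def linear_iff prod.inj_map)
  have "b' e \<in> frames ?k" if e: "linear (T e)" "inj (T e)" for e
  proof -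
    have "inj_on (b' e) {..<?k}"
      using b(1) comp_inj_on[OF _ inj_on_subset[OF A(2)[OF e] subset_UNIV], of b "{..<?k}"]
      by (simp add: frames_def b'_def inj_on_restrict_eq o_def)
    moreover have "independent (b' e ` {..<?k})"
      unfolding im using b(1) inj_on_subset[OF A(2)[OF e] subset_UNIV]
      by (intro linear_independent_injective_image[OF A(1)[OF e]]) (simp_all add: frames_def)
    ultimately show ?thesis by (simp add: frames_def b'_def)
  qed
  then have fr: "\<forall>\<^sub>F e in F. b' e \<in> frames ?k"
    using T by (auto elim: eventually_mono)
  have "((\<lambda>e. A e p) \<longlongrightarrow> p) F" for p
    using tendsto_Pair[OF tendsto_const lim, of "fst p" "snd p"]
    by (simp add: A_def map_prod_def case_prod_beta)
  then have "limitin (frame_topology ?k) b' b F"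
    unfolding frame_topology_def limitin_subtopology limitin_componentwise
    using b(1) fr by (auto simp: b'_def frames_def PiE_def)
  moreover have "openin (frame_topology ?k) {b \<in> frames ?k. span (b ` {..<?k}) \<in> U}"
    using U unfolding openin_grassmannian by blast
  moreover have "b \<in> {b \<in> frames ?k. span (b ` {..<?k}) \<in> U}"
    using b N NU by auto
  ultimately have "\<forall>\<^sub>F e in F. b' e \<in> {b \<in> frames ?k. span (b ` {..<?k}) \<in> U}"
    unfolding limitin_def by blast
  then have "\<forall>\<^sub>F e in F. span (b' e ` {..<?k}) \<in> U"
    by (rule eventually_mono) simp
  with T show "\<forall>\<^sub>F e in F. T e ` L \<in> N"
  proof eventually_elim
    case (elim e)
    then have e: "linear (T e)" "inj (T e)" by auto
    have "span (b' e ` {..<?k}) = A e ` homogenization L"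
      unfolding im b(2)[symmetric] by (rule linear_span_image[OF A(1)[OF e]])
    then have "homogenization (T e ` L) \<in> U"
      using elim by (simp add: homogenization_linear_image[OF e(1)] A_def)
    moreover have "affine (T e ` L)"
      using L(1) affine_hull_linear_image[of "T e" L] e(1)
      by (metis affine_affine_hull affine_hull_eq linear_conv_bounded_linear)
    ultimately show ?case using e L(2) NU by simp
  qed
qed

section \<open>Cones and affine subspaces\<close>

lemma snd_homogenization: "snd ` homogenization L = span L"
proof -
  have "snd ` ({1::real} \<times> L) = L" by force
  then show ?thesis
    unfolding homogenization_def using linear_span_image[OF linear_snd, of "{1::real} \<times> L"] by simp
qed

text \<open>Lift \<open>x\<close> to some \<open>(t, x)\<close> in \<open>homogenization L\<close>.
  If \<open>t\<close> is nonzero, rescaling to height 1 gives a point of \<open>L\<close>. If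
  \<open>t = 0\<close>, adding multiples of the lift to \<open>(1, y)\<close> stays at height 1, so
  \<open>x\<close> is a direction.\<close>

lemma span_affine_cases:
  fixes L :: "'a::euclidean_space set"
  assumes L: "affine L" and x: "x \<in> span L"
  obtains (multiple) t z where "t \<noteq> 0" "z \<in> L" "x = t *\<^sub>R z"
    | (direction) "\<And>y s. y \<in> L \<Longrightarrow> y + s *\<^sub>R x \<in> L"
proof -
  obtain t where tx: "(t, x) \<in> homogenization L"
    using x unfolding snd_homogenization[symmetric] by auto
  have sub: "subspace (homogenization L)" by (simp add: homogenization_def)
  show thesis
  proof (cases "t = 0")
    case True
    have "y + s *\<^sub>R x \<in> L" if "y \<in> L" for y s
      using subspace_add[OF sub _ subspace_mul[OF sub tx], of "(1, y)" s] that True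
      by (simp add: homogenization_slice[OF L])
    then show thesis by (rule direction)
  next
    case False
    then have "(1 / t) *\<^sub>R x \<in> L"
      using subspace_mul[OF sub tx, of "1 / t"] by (simp add: homogenization_slice[OF L])
    then show thesis using False multiple[of t "(1 / t) *\<^sub>R x"] by simp
  qed
qed

text \<open>For large \<open>c\<close> the point \<open>u + (1 / c) *\<^sub>R z\<close> is still in
  \<open>K\<close>. Scaling it by \<open>c\<close> and adding \<open>(c / e) *\<^sub>R x\<close>
  yields the claim with \<open>s = c / e\<close>.\<close>

lemma convex_cone_add_interior_absorbs:
  fixes K :: "'a::real_normed_vector set"
  assumes K: "convex K" "cone K" and x: "x \<in> K" and u: "u \<in> interior K" and e: "e > 0"
  obtains s where "z + s *\<^sub>R (x + e *\<^sub>R u) \<in> K"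
proof -
  obtain r where r: "r > 0" "ball u r \<subseteq> K" using u by (auto simp: mem_interior)
  define c where "c = (norm z + 1) / r"
  have c: "c > 0" using r by (simp add: c_def add_nonneg_pos)
  have "norm ((1 / c) *\<^sub>R z) < r"
    using r c by (simp add: c_def field_simps add_nonneg_pos)
  then have "u + (1 / c) *\<^sub>R z \<in> K"
    using r by (auto simp: dist_norm)
  then have "c *\<^sub>R (u + (1 / c) *\<^sub>R z) \<in> K"
    using K(2) c by (simp add: cone_def)
  moreover have "(c / e) *\<^sub>R x \<in> K"
    using K(2) x c e by (simp add: cone_def)
  ultimately have "c *\<^sub>R (u + (1 / c) *\<^sub>R z) + (c / e) *\<^sub>R x \<in> K"
    using K convex_cone by blast
  moreover have "c *\<^sub>R (u + (1 / c) *\<^sub>R z) + (c / e) *\<^sub>R x = z + (c / e) *\<^sub>R (x + e *\<^sub>R u)"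
    using c e by (simp add: algebra_simps)
  ultimately show thesis using that by metis
qed

section \<open>Functionals in the interior of the dual cone\<close>

lemma interior_dual_cone:
  fixes K :: "'a::euclidean_space set"
  assumes "closed K" "cone K"
  shows "interior (dual_cone K) = {l. \<forall>x\<in>K - {0}. blinfun_apply l x > 0}"
proof (intro set_eqI iffI)
  fix l assume "l \<in> interior (dual_cone K)"
  then obtain r where r: "r > 0" "cball l r \<subseteq> dual_cone K" by (auto simp: mem_interior_cball)
  have "blinfun_apply l x > 0" if x: "x \<in> K" "x \<noteq> 0" for x
  proof -
    \<comment> \<open>Tilting \<open>l\<close> slightly against the inner product with
      \<open>x\<close> keeps it in the dual cone, which bounds its value at \<open>x\<close> below
      by a positive multiple of \<open>x \<bullet> x\<close>.\<close>
    define h where "h = blinfun_inner_left x"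
    define e where "e = r / (norm h + 1)"
    have e: "e > 0" using r by (simp add: e_def add_nonneg_pos)
    have "e * norm h \<le> r"
      using r by (simp add: e_def pos_divide_le_eq add_nonneg_pos)
    then have "l - e *\<^sub>R h \<in> dual_cone K"
      using r e by (intro subsetD[OF r(2)]) (simp add: dist_norm)
    then have "blinfun_apply l x \<ge> e * (x \<bullet> x)"
      using x by (auto simp: dual_cone_def blinfun.diff_left blinfun.scaleR_left h_def)
    then show ?thesis using e x by (smt (verit) inner_gt_zero_iff mult_pos_pos)
  qed
  then show "l \<in> {l. \<forall>x\<in>K - {0}. blinfun_apply l x > 0}" by auto
next
  fix l :: "'a \<Rightarrow>\<^sub>L real"
  assume l: "l \<in> {l. \<forall>x\<in>K - {0}. blinfun_apply l x > 0}"
  let ?S = "K \<inter> sphere 0 1"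
  \<comment> \<open>The minimum of \<open>l\<close> on the unit vectors of \<open>K\<close> is a
    radius by which \<open>l\<close> can be moved. If there are no such vectors, any radius
    serves.\<close>
  obtain m where m: "m > 0" "\<And>x. x \<in> ?S \<Longrightarrow> blinfun_apply l x \<ge> m"
  proof (cases "?S = {}")
    case True
    then show thesis using that[of 1] by auto
  next
    case False
    have "compact ?S" using assms(1) by (simp add: closed_Int_compact)
    then obtain x where "x \<in> ?S" "\<And>y. y \<in> ?S \<Longrightarrow> blinfun_apply l x \<le> blinfun_apply l y"
      using continuous_attains_inf[OF _ False, of "blinfun_apply l"]
        blinfun.continuous_on[OF continuous_on_const continuous_on_id, of ?S l]
      by auto
    then show thesis using l by (intro that[of "blinfun_apply l x"]) auto
  qed
  have "ball l m \<subseteq> dual_cone K"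
  proof
    fix l' assume l': "l' \<in> ball l m"
    have "blinfun_apply l' x \<ge> 0" if x: "x \<in> K" for x
    proof (cases "x = 0")
      case False
      let ?y = "(1 / norm x) *\<^sub>R x"
      have y: "?y \<in> ?S" using x False assms(2) by (simp add: cone_def)
      have "norm (blinfun_apply (l - l') ?y) \<le> norm (l - l') * norm ?y"
        by (rule norm_blinfun)
      also have "\<dots> < m" using l' False by (simp add: dist_norm)
      finally have "blinfun_apply l' ?y > 0"
        using m(2)[OF y] by (auto simp: blinfun.diff_left abs_if split: if_splits)
      then show ?thesis using False by (simp add: blinfun.scaleR_right zero_less_divide_iff)
    qed (simp add: blinfun.zero_right)
    then show "l' \<in> dual_cone K" by (simp add: dual_cone_def)
  qed
  then show "l \<in> interior (dual_cone K)" using m(1) by (auto simp: mem_interior)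
qed

text \<open>This keeps the convex hull of the unit vectors of \<open>K\<close> away from 0. A
  vanishing combination would make \<open>u *\<^sub>R x\<close> a point of both \<open>K\<close> and
  \<open>-K\<close>, forcing both summands to be 0.\<close>

lemma convex_pointed_cone_minus_zero:
  assumes "convex K" "cone K" "K \<inter> uminus ` K \<subseteq> {0}"
  shows "convex (K - {0})"
proof (rule convexI)
  fix x y and u v :: real
  assume xy: "x \<in> K - {0}" "y \<in> K - {0}" and uv: "0 \<le> u" "0 \<le> v" "u + v = 1"
  have K: "u *\<^sub>R x \<in> K" "v *\<^sub>R y \<in> K" using assms(2) xy uv by (auto simp: cone_def)
  have "u *\<^sub>R x + v *\<^sub>R y \<noteq> 0"
  proof
    assume 0: "u *\<^sub>R x + v *\<^sub>R y = 0"
    then have "u *\<^sub>R x = - (v *\<^sub>R y)" by (simp add: eq_neg_iff_add_eq_0)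
    then have "u *\<^sub>R x \<in> K \<inter> uminus ` K" using K by blast
    then have "u *\<^sub>R x = 0" "v *\<^sub>R y = 0" using assms(3) 0 by auto
    then show False using xy uv by auto
  qed
  moreover have "u *\<^sub>R x + v *\<^sub>R y \<in> K" using assms(1) xy uv by (auto simp: convex_def)
  ultimately show "u *\<^sub>R x + v *\<^sub>R y \<in> K - {0}" by simp
qed

lemma separating_functional_exists:
  fixes K L :: "'a::euclidean_space set"
  assumes K: "closed K" "convex K" "cone K" "K \<inter> uminus ` K \<subseteq> {0}"
    and L: "affine L" "L \<noteq> {}" "0 \<notin> L" and KL: "K \<inter> span L = {0}"
  shows "\<exists>l \<in> interior (dual_cone K). \<forall>x\<in>L. blinfun_apply l x < 0"
proof -
  obtain y where y: "y \<in> L" using L(2) by blast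
  define E where "E = (\<lambda>x. x - y) ` L"
  have E: "subspace E"
    unfolding E_def by (rule affine_diffs_subspace_subtract[OF L(1) y])
  have EL: "E \<subseteq> span L"
    using y by (auto simp: E_def intro: span_diff span_base)
  have yE: "- y \<notin> E" using L(3) by (auto simp: E_def)
  define S where "S = K \<inter> sphere 0 1"
  define H where "H = convex hull (insert (- y) S)"
  have S: "convex hull S \<subseteq> K - {0}"
    using convex_pointed_cone_minus_zero[OF K(2-4)] by (intro hull_minimal) (auto simp: S_def)
  have "compact S" unfolding S_def using K(1) by (simp add: closed_Int_compact)
  then have H: "compact H" unfolding H_def by (intro compact_convex_hull compact_insert)
  \<comment> \<open>A common point involves some \<open>s\<close> in the hull of \<open>S\<close>.
    With positive weight on \<open>s\<close>, adding back the multiple of \<open>y\<close> places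
    the nonzero \<open>s\<close> in \<open>K \<inter> span L\<close>. With weight 0 it is
    \<open>- y\<close>, and \<open>- y\<close> in \<open>E\<close> would mean 0 in
    \<open>L\<close>.\<close>
  have "H \<inter> E = {}"
  proof (cases "S = {}")
    case True
    then show ?thesis using yE by (simp add: H_def)
  next
    case False
    have False if uv: "u \<ge> 0" "v \<ge> 0" "u + v = 1" and s: "s \<in> convex hull S"
      and e: "u *\<^sub>R (- y) + v *\<^sub>R s \<in> E" for u v s
    proof (cases "v = 0")
      case True
      then show False using uv e yE by simp
    next
      case v: False
      have "(u *\<^sub>R (- y) + v *\<^sub>R s) + u *\<^sub>R y \<in> span L"
        using span_add[OF subsetD[OF EL e] span_scale[OF span_base[OF y]]] .
      then have "v *\<^sub>R s \<in> span L" by simp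
      then have "s \<in> span L" using v span_scale[of "v *\<^sub>R s" L "1 / v"] by simp
      then show False using s S KL by blast
    qed
    then show ?thesis unfolding H_def convex_hull_insert[OF False] by fastforce
  qed
  then obtain a \<beta> where a: "\<And>x. x \<in> H \<Longrightarrow> a \<bullet> x < \<beta>" "\<And>x. x \<in> E \<Longrightarrow> a \<bullet> x > \<beta>"
    using separating_hyperplane_compact_closed[of H E] H subspace_imp_convex[OF E] closed_subspace[OF E]
      convex_convex_hull[of "insert (- y) S"]
    by (metis H_def empty_not_insert convex_hull_eq_empty)
  have "\<beta> < 0" using a(2)[OF subspace_0[OF E]] by simp
  \<comment> \<open>A linear form bounded below on a subspace vanishes there: otherwise some
    multiple of \<open>x\<close> would attain the excluded value \<beta>.\<close>
  have aE: "a \<bullet> x = 0" if x: "x \<in> E" for x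
  proof (rule ccontr)
    assume ne: "a \<bullet> x \<noteq> 0"
    have "(\<beta> / (a \<bullet> x)) *\<^sub>R x \<in> E" by (rule subspace_mul[OF E x])
    from a(2)[OF this] ne show False by simp
  qed
  have aH: "a \<bullet> x < 0" if "x \<in> insert (- y) S" for x
    using a(1)[of x] that \<open>\<beta> < 0\<close> by (force simp: H_def intro: hull_inc)
  define l where "l = blinfun_inner_left (- a)"
  have "blinfun_apply l x > 0" if "x \<in> K - {0}" for x
  proof -
    have "(1 / norm x) *\<^sub>R x \<in> S" using that K(3) by (simp add: S_def cone_def)
    then have "a \<bullet> ((1 / norm x) *\<^sub>R x) < 0" using aH by blast
    then show ?thesis
      using that by (simp add: l_def inner_commute divide_less_0_iff)
  qed
  moreover have "blinfun_apply l x < 0" if "x \<in> L" for x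
  proof -
    have "a \<bullet> (x - y) = 0" using that by (intro aE) (simp add: E_def)
    moreover have "a \<bullet> y > 0" using aH[of "- y"] by simp
    ultimately show ?thesis by (simp add: l_def inner_commute inner_diff_right)
  qed
  ultimately show ?thesis
    using K by (auto simp: interior_dual_cone intro!: bexI[of _ l])
qed

section \<open>Stable infeasibility\<close>

lemma stably_infeasible_if_Int_span_eq_zero:
  fixes K L :: "'a::euclidean_space set"
  assumes K: "closed K" "cone K"
    and L: "affine L" "L \<noteq> {}" "0 \<notin> L" and KL: "K \<inter> span L = {0}"
  shows "stably_infeasible K L"
proof -
  define d where "d = nat (aff_dim L)"
  have d: "aff_dim L = int d"
    using L(2) aff_dim_negative_iff[of L] unfolding d_def by linarith
  \<comment> \<open>A point \<open>x\<close> of \<open>K\<close> on \<open>L'\<close> becomes the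
    nonzero vector \<open>(1, x)\<close> of \<open>C\<close> in \<open>homogenization L'\<close>, so
    trivial intersection with \<open>C\<close> is a linear condition that rules out all such
    points.\<close>
  define C :: "(real \<times> 'a) set" where "C = {0..} \<times> K"
  define N where "N = homogenization -` {W. subspace W \<and> dim W = d + 1 \<and> W \<inter> C \<subseteq> {0}} \<inter>
    {L :: 'a set. affine L \<and> aff_dim L = int d}"
  have "closed C" "cone C"
    using K by (auto simp: C_def closed_Times cone_def)
  then have "openin (affine_grassmannian d) N"
    unfolding N_def affine_grassmannian_def openin_pullback_topology
    using openin_grassmannian_Int_cone by blast
  moreover have "L \<in> N"
  proof -
    have sub: "subspace (homogenization L)" by (simp add: homogenization_def)
    \<comment> \<open>The hypothesis on \<open>span L\<close> kills \<open>x\<close>; a nonzero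
      \<open>t\<close> would then put 0 on \<open>L\<close>.\<close>
    have "(t, x) = 0" if tx: "(t, x) \<in> homogenization L" "x \<in> K" for t x
    proof -
      have "x \<in> span L" using tx(1) unfolding snd_homogenization[symmetric] by force
      then have x: "x = 0" using tx(2) KL by blast
      have "t = 0"
      proof (rule ccontr)
        assume "t \<noteq> 0"
        then have "(1, 0) \<in> homogenization L"
          using subspace_mul[OF sub tx(1), of "1 / t"] x by simp
        then show False using homogenization_slice[OF L(1)] L(3) by blast
      qed
      then show ?thesis using x by (simp add: zero_prod_def)
    qed
    then show ?thesis
      using L(1) d sub dim_homogenization[OF L(1) d] by (auto simp: N_def C_def)
  qed
  moreover have "K \<inter> L' = {}" if "L' \<in> N" for L'
  proof -
    have "(1, x) \<notin> homogenization L'" if "x \<in> K" for x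
      using \<open>L' \<in> N\<close> that by (force simp: N_def C_def zero_prod_def)
    then show ?thesis using \<open>L' \<in> N\<close> by (auto simp: N_def homogenization_slice)
  qed
  ultimately show ?thesis unfolding stably_infeasible_def d_def by blast
qed

lemma not_stably_infeasible_if_direction:
  fixes K L :: "'a::euclidean_space set"
  assumes K: "convex K" "cone K" "interior K \<noteq> {}"
    and L: "affine L" "L \<noteq> {}"
    and x: "x \<in> K" "x \<noteq> 0" "\<And>y s. y \<in> L \<Longrightarrow> y + s *\<^sub>R x \<in> L"
  shows "\<not> stably_infeasible K L"
proof
  assume "stably_infeasible K L"
  then obtain N where N: "openin (affine_grassmannian (nat (aff_dim L))) N" "L \<in> N"
    "\<And>L'. L' \<in> N \<Longrightarrow> K \<inter> L' = {}"
    by (auto simp: stably_infeasible_def)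
  obtain y u where y: "y \<in> L" and u: "u \<in> interior K" using L K by blast
  \<comment> \<open>The normalization gives \<open>\<phi> x = 1\<close>, so \<open>T e\<close> sends
    the direction \<open>x\<close> to \<open>x + e *\<^sub>R u\<close>, while \<open>T e\<close>
    tends to the identity as \<open>e\<close> tends to 0.\<close>
  define \<phi> where "\<phi> = (\<lambda>z. (x \<bullet> z) / (x \<bullet> x))"
  define T where "T = (\<lambda>e z. z + (e * \<phi> z) *\<^sub>R u)"
  have lin: "linear (T e)" for e
    by (simp add: linear_iff T_def \<phi>_def inner_right_distrib add_divide_distrib algebra_simps)
  have inj: "inj (T e)" if e: "1 + e * \<phi> u > 0" for e
  proof -
    have "z = 0" if z: "T e z = 0" for z
    proof -
      \<comment> \<open>\<open>T e\<close> acts on the value of \<phi> by a scalar factor, and it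
        moves only vectors where \<phi> is nonzero. A positive factor therefore suffices for
        injectivity.\<close>
      have "\<phi> (T e z) = \<phi> z * (1 + e * \<phi> u)"
        by (simp add: T_def \<phi>_def inner_right_distrib add_divide_distrib algebra_simps)
      then have "\<phi> z = 0" using z e by (simp add: \<phi>_def)
      then show "z = 0" using z by (simp add: T_def)
    qed
    then show ?thesis using linear_injective_0[OF lin] by blast
  qed
  have "((\<lambda>e. 1 + e * \<phi> u) \<longlongrightarrow> 1 + 0 * \<phi> u) (at_right 0)"
    by (intro tendsto_intros)
  then have "\<forall>\<^sub>F e in at_right 0. 1 + e * \<phi> u > 0"
    by (rule order_tendstoD) simp
  then have "\<forall>\<^sub>F e in at_right 0. linear (T e) \<and> inj (T e)"
    by eventually_elim (simp add: lin inj)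
  moreover have "((\<lambda>e. T e z) \<longlongrightarrow> z) (at_right 0)" for z
  proof -
    have "((\<lambda>e. T e z) \<longlongrightarrow> z + (0 * \<phi> z) *\<^sub>R u) (at_right 0)"
      unfolding T_def by (intro tendsto_intros)
    then show ?thesis by simp
  qed
  moreover have "aff_dim L = int (nat (aff_dim L))"
    using L(2) aff_dim_negative_iff[of L] by linarith
  ultimately have "limitin (affine_grassmannian (nat (aff_dim L))) (\<lambda>e. T e ` L) L (at_right 0)"
    using L(1) by (intro limitin_affine_grassmannian_linear_image)
  then have "\<forall>\<^sub>F e in at_right 0. T e ` L \<in> N"
    using N(1,2) by (simp add: limitin_def)
  then have "\<forall>\<^sub>F e in at_right 0. e > (0::real) \<and> T e ` L \<in> N"
    using eventually_at_right_less eventually_conj by blast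
  then obtain e where e: "e > 0" "T e ` L \<in> N"
    using eventually_happens trivial_limit_at_right_real by blast
  \<comment> \<open>The line through \<open>T e y\<close> in the tilted direction enters
    \<open>K\<close>; it is the image of a line contained in \<open>L\<close>.\<close>
  obtain s where s: "T e y + s *\<^sub>R (x + e *\<^sub>R u) \<in> K"
    using convex_cone_add_interior_absorbs[OF K(1,2) x(1) u e(1)] .
  have "\<phi> x = 1" using x(2) by (simp add: \<phi>_def)
  then have "T e (y + s *\<^sub>R x) = T e y + s *\<^sub>R (x + e *\<^sub>R u)"
    using lin[of e] by (simp add: linear_add linear_cmul) (simp add: T_def scaleR_right_distrib)
  then have "T e (y + s *\<^sub>R x) \<in> K \<inter> T e ` L" using s imageI[OF x(3)[OF y]] by (metis IntI)
  then show False using N(3)[OF e(2)] by blast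
qed

text \<open>Dividing \<open>x\<close> by the modulus of \<open>t\<close> gives \<open>z\<close> or
  \<open>- z\<close> according to the sign of \<open>t\<close>; since \<open>-K\<close> misses
  \<open>L\<close>, the negative sign cannot occur.\<close>

lemma Int_span_affine_cases:
  fixes K L :: "'a::euclidean_space set"
  assumes K: "cone K" and L: "affine L" and nK: "uminus ` K \<inter> L = {}"
    and x: "x \<in> K" "x \<in> span L"
  obtains (multiple) t z where "t > 0" "z \<in> K" "z \<in> L" "x = t *\<^sub>R z"
    | (direction) "\<And>y s. y \<in> L \<Longrightarrow> y + s *\<^sub>R x \<in> L"
  using L x(2)
proof (cases rule: span_affine_cases)
  case (multiple t z)
  have "(1 / \<bar>t\<bar>) *\<^sub>R x \<in> K" using K x(1) by (simp add: cone_def)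
  moreover have "(1 / \<bar>t\<bar>) *\<^sub>R x = (if t > 0 then z else - z)"
    using multiple by auto
  moreover have "- z \<notin> K" using nK multiple(2) by force
  ultimately show thesis using multiple that(1) by (auto split: if_splits)
qed (rule that(2))

theorem corollary2p11:
  fixes K L :: "'a::euclidean_space set"
  assumes "regular_cone K"
    and "affine L" and "L \<noteq> {}"
    and "0 \<notin> L"
    and "int DIM('a) - aff_dim L \<ge> 2"
    and "uminus ` K \<inter> L = {}"
  shows "(K \<inter> span L = {0} \<longleftrightarrow> stably_infeasible K L) \<and>
         ((\<exists>l \<in> interior (dual_cone K). \<forall>x\<in>L. blinfun_apply l x < 0) \<longleftrightarrow> stably_infeasible K L)"
proof -
  have K: "closed K" "convex K" "cone K" "K \<inter> uminus ` K = {0}" "interior K \<noteq> {}"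
    using assms(1) by (auto simp: regular_cone_def)
  have "0 \<in> K" using K(4) by blast
  then have zero: "0 \<in> K \<inter> span L" by (simp add: span_zero)
  have 1: "K \<inter> span L = {0}" if st: "stably_infeasible K L"
  proof -
    have "K \<inter> L = {}" using st by (auto simp: stably_infeasible_def)
    have "x = 0" if x: "x \<in> K" "x \<in> span L" for x
      using K(3) assms(2,6) x
    proof (cases rule: Int_span_affine_cases)
      case multiple
      then show ?thesis using \<open>K \<inter> L = {}\<close> by blast
    next
      case direction
      then show ?thesis
        using not_stably_infeasible_if_direction[OF K(2,3,5) assms(2,3) x(1)] st by blast
    qed
    then show ?thesis using zero by blast
  qed
  have 2: "K \<inter> span L = {0}"
    if l: "l \<in> interior (dual_cone K)" "\<forall>x\<in>L. blinfun_apply l x < 0" for l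
  proof -
    have pos: "blinfun_apply l x > 0" if "x \<in> K" "x \<noteq> 0" for x
      using l(1) that by (simp add: interior_dual_cone[OF K(1,3)])
    have "x = 0" if x: "x \<in> K" "x \<in> span L" for x
      using K(3) assms(2,6) x
    proof (cases rule: Int_span_affine_cases)
      case (multiple t z)
      then show ?thesis using pos[of z] l(2) assms(4) by force
    next
      case direction
      obtain y where y: "y \<in> L" using assms(3) by blast
      \<comment> \<open>At this parameter \<open>l\<close> would vanish on a point of
        \<open>L\<close>, where it is negative.\<close>
      let ?s = "- blinfun_apply l y / blinfun_apply l x"
      have "blinfun_apply l (y + ?s *\<^sub>R x) < 0" using direction[OF y] l(2) by blast
      then show ?thesis
        using pos[OF x(1)] by (cases "x = 0") (auto simp: blinfun.add_right blinfun.diff_right blinfun.scaleR_right)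
    qed
    then show ?thesis using zero by blast
  qed
  have 3: "stably_infeasible K L" if "K \<inter> span L = {0}"
    using stably_infeasible_if_Int_span_eq_zero[OF K(1,3) assms(2-4) that] .
  have 4: "\<exists>l \<in> interior (dual_cone K). \<forall>x\<in>L. blinfun_apply l x < 0" if "K \<inter> span L = {0}"
    using separating_functional_exists[OF K(1-3) _ assms(2-4) that] K(4) by simp
  show ?thesis using 1 2 3 4 by blast
qed

end
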